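(* Let $n\ge 1$. Then (1) $\displaystyle\sum_{\pi\in B_n}(-1)^{\ell_B(\pi)}q^{\mathrm{Fmaj}(\pi)}=\prod_{k=1}^n[2]_{(-1)^kq}\,[k]_{(-1)^{k-1}q^2}$; (2) $\displaystyle\sum_{\pi\in B_n}(-1)^{\mathrm{neg}(\pi)}q^{\mathrm{Fmaj}(\pi)} =\prod_{k=1}^n[2]_{-q}\,[k]_{q^2}$; (3) $\displaystyle\sum_{\pi\in B_n}(-1)^{\mathrm{inv}(|\pi|)}q^{\mathrm{Fmaj}(\pi)} =\prod_{k=1}^n[2]_{(-1)^{k-1}q}\,[k]_{(-1)^{k-1}q^2}$.
   Context: For an integer $m\ge 0$ and any quantity $p$, $[m]_p:=1+p+\cdots+p^{m-1}$. $B_n$ is the group of signed permutations: bijections $\pi$ of $\{\pm1,\dots,\pm n\}$ with $\pi(-i)=-\pi(i)$, written $\pi=\pi_1\cdots\pi_n$ with $\pi_i=\pi(i)$. Put $|\pi|:=|\pi_1|\cdots|\pi_n|\in\mathfrak S_n$, $\mathrm{Neg}(\pi):=\{i\in\{1,\dots,n\}:\pi_i<0\}$ and $\mathrm{neg}(\pi):=|\mathrm{Neg}(\pi)|$. With respect to the usual order of the integers, $\mathrm{inv}(\pi):=|\{(i,j):1\le i<j\le n,\ \pi_i>\pi_j\}|$ and $\mathrm{maj}(\pi):=\sum_{1\le i\le n-1,\ \pi_i>\pi_{i+1}} i$. $\ell_B$ is the Coxeter length function of $B_n$ with respect to the generators $s_0=(1,-1)$ and $s_i=(i,i+1)$, $1\le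 i\le n-1$; it satisfies $\ell_B(\pi)=\mathrm{inv}(\pi)-\sum_{i\in\mathrm{Neg}(\pi)}\pi_i$. The F-major index is $\mathrm{Fmaj}(\pi):=2\,\mathrm{maj}(\pi)+\mathrm{neg}(\pi)$. *)

theory Defs
  imports "HOL-Combinatorics.Permutations"
begin

definition qbracket :: "nat \<Rightarrow> 'a::comm_ring_1 \<Rightarrow> 'a" where
  "qbracket m p = (\<Sum>i<m. p ^ i)"

definition signed_ground :: "nat \<Rightarrow> int set" where
  "signed_ground n = {- int n..int n} - {0}"

text \<open>Bijections of the ground set are represented, as usual for \<open>permutes\<close>, by functions
  on all integers that are the identity outside the ground set.\<close>

definition signed_perms :: "nat \<Rightarrow> (int \<Rightarrow> int) set" where
  "signed_perms n =
     {\<pi>. \<pi> permutes signed_ground n \<and> (\<forall>i\<in>signed_ground n. \<pi> (- i) = - \<pi> i)}"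

lemma finite_signed_perms: "finite (signed_perms n)"
  unfolding signed_perms_def signed_ground_def
  by (rule finite_subset[OF _ finite_permutations[of "{- int n..int n} - {0}"]]) auto

definition abs_perm :: "nat \<Rightarrow> (int \<Rightarrow> int) \<Rightarrow> int \<Rightarrow> int" where
  "abs_perm n \<pi> = (\<lambda>i. if i \<in> {1..int n} then \<bar>\<pi> i\<bar> else i)"

definition Neg :: "nat \<Rightarrow> (int \<Rightarrow> int) \<Rightarrow> int set" where
  "Neg n \<pi> = {i \<in> {1..int n}. \<pi> i < 0}"

definition neg :: "nat \<Rightarrow> (int \<Rightarrow> int) \<Rightarrow> nat" where
  "neg n \<pi> = card (Neg n \<pi>)"

definition inv_num :: "nat \<Rightarrow> (int \<Rightarrow> int) \<Rightarrow> nat" where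
  "inv_num n \<pi> = card {(i, j). 1 \<le> i \<and> i < j \<and> j \<le> int n \<and> \<pi> i > \<pi> j}"

definition maj :: "nat \<Rightarrow> (int \<Rightarrow> int) \<Rightarrow> nat" where
  "maj n \<pi> = (\<Sum>i | 1 \<le> i \<and> i < n \<and> \<pi> (int i) > \<pi> (int i + 1). i)"

definition Fmaj :: "nat \<Rightarrow> (int \<Rightarrow> int) \<Rightarrow> nat" where
  "Fmaj n \<pi> = 2 * maj n \<pi> + neg n \<pi>"

text \<open>As a signed permutation, the generator written \<open>(i, i + 1)\<close> also exchanges
  \<open>-i\<close> and \<open>-(i + 1)\<close>.\<close>

definition B_gen :: "nat \<Rightarrow> int \<Rightarrow> int" where
  "B_gen i =
     (if i = 0 then transpose 1 (-1)
      else transpose (int i) (int i + 1) \<circ> transpose (- int i) (- (int i + 1)))"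

text \<open>Coxeter length. The generators are involutions and generate \<open>signed_perms n\<close>, so a
  word exists for each of its elements and no inverses are needed.\<close>

definition B_length :: "nat \<Rightarrow> (int \<Rightarrow> int) \<Rightarrow> nat" where
  "B_length n \<pi> =
     (LEAST k. \<exists>ws. length ws = k \<and> set ws \<subseteq> {..<n} \<and> foldr (\<circ>) (map B_gen ws) id = \<pi>)"

end

theory Submission
  imports Defs
begin

text \<open>All three signs are products of two independent parts. Let \<open>J\<close> be the set of absolute values of the
  negative entries of \<open>\<pi>\<close>, and \<open>w\<close> the permutation with the same relative order as
  \<open>\<pi>\<^sub>1 \<dots> \<pi>\<^sub>n\<close>. The pair \<open>(J, w)\<close> determines \<open>\<pi>\<close>, with \<open>inv \<pi> = inv w\<close>,
  \<open>maj \<pi> = maj w\<close> and \<open>neg \<pi> = card J\<close>; and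

  \<^item> \<open>(-1) ^ inv \<bar>\<pi>\<bar> = (-1) ^ inv w * (\<Prod>j\<in>J. (-1) ^ (j - 1))\<close>, because comparing absolute values
    reverses exactly the pairs in which the entry of larger absolute value is negative
    (\<open>minus_one_inv_abs_perm\<close>);
  \<^item> \<open>(-1) ^ \<ell>\<^sub>B \<pi> = (-1) ^ inv w * (\<Prod>j\<in>J. (-1) ^ j)\<close>, because every Coxeter generator changes the
    parity of \<open>inv \<bar>\<pi>\<bar> + neg \<pi>\<close> (\<open>minus_one_B_length\<close>).

  Hence each sum factors into a sum over subsets \<open>J\<close>, which is the expansion of the product of the factors
  \<open>[2]\<close>, and a sum of \<open>e ^ inv w * (q\<^sup>2) ^ maj w\<close> over permutations, where \<open>e\<close> is \<open>1\<close> or \<open>-1\<close>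
  (\<open>sum_signed_perms_inv_maj\<close>).

  The latter is evaluated by shifting values cyclically (\<open>sum_perms_inv_maj\<close>). A permutation whose last
  value is \<open>n - k\<close> with \<open>k \<ge> 1\<close> is sent to one with last value \<open>n - k + 1\<close>; this lowers \<open>maj\<close> by
  \<open>1\<close> (\<open>maj_cycle_up\<close>) and multiplies the sign by that of an \<open>n\<close>-cycle (\<open>sign_inv_cycle_up\<close>).
  So the permutations with last value \<open>n - k\<close> contribute \<open>(e ^ (n - 1) * q) ^ k\<close> times the sum
  for \<open>n - 1\<close>, where \<open>q\<close> marks \<open>maj\<close>, and summing over \<open>k < n\<close> produces one bracket factor.\<close>

section \<open>Cyclic shifts of values and the major index\<close>

lemma power_cong_parity:
  fixes e :: "'a::monoid_mult"
  assumes "e * e = 1" and "even (a + b)"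
  shows "e ^ a = e ^ b"
proof -
  have "e ^ k = (if even k then 1 else e)" for k
    by (induction k) (auto simp: assms(1))
  thus ?thesis using assms(2) by simp
qed

text \<open>The cycle \<open>1 \<mapsto> 2 \<mapsto> \<dots> \<mapsto> n \<mapsto> 1\<close>; composed on the left of a
  permutation it shifts the values cyclically.\<close>

definition cycle_up :: "nat \<Rightarrow> int \<Rightarrow> int" where
  "cycle_up n x = (if x = int n then 1 else if 1 \<le> x \<and> x < int n then x + 1 else x)"

lemma cycle_up_permutes:
  assumes "n \<ge> 1"
  shows "cycle_up n permutes {1..int n}"
proof (rule bij_imp_permutes)
  show "bij_betw (cycle_up n) {1..int n} {1..int n}"
    by (rule bij_betw_byWitness[where f' = "\<lambda>y. if y = 1 then int n else y - 1"])
       (use assms in \<open>auto simp: cycle_up_def\<close>)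
qed (use assms in \<open>auto simp: cycle_up_def\<close>)

text \<open>Only comparisons with the position \<open>p\<close> of the value \<open>n\<close> change under the shift, since that
  value turns into the smallest one. As \<open>p < n\<close>, position \<open>p\<close> is a descent that disappears, and
  in exchange position \<open>p - 1\<close> becomes one (if \<open>p > 1\<close>; if \<open>p = 1\<close>, the sum just loses
  \<open>1\<close>). Either way the sum of the descents drops by \<open>1\<close>.\<close>

lemma maj_cycle_up:
  assumes u: "u permutes {1..int n}" and last: "u (int n) < int n"
  shows "maj n u = Suc (maj n (cycle_up n \<circ> u))"
proof -
  have n: "n \<ge> 1" using last permutes_not_in[OF u, of "int n"] by (cases n) auto
  obtain p where p: "p \<in> {1..int n}" "u p = int n"
    using permutes_image[OF u] n by (metis atLeastAtMost_iff imageE of_nat_1 of_nat_le_iff order_refl)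
  define m where "m = nat p"
  have pm: "p = int m" "1 \<le> m" "m < n" using p last by (auto simp: m_def less_le)
  have rng: "1 \<le> u (int i) \<and> u (int i) \<le> int n" if "1 \<le> i" "i \<le> n" for i
    using permutes_in_image[OF u, of "int i"] that by auto
  have top: "u (int i) = int n \<longleftrightarrow> i = m" for i
    using permutes_inj[OF u] p(2) pm(1) by (metis inj_eq of_nat_eq_iff)
  define D where "D v = {i. 1 \<le> i \<and> i < n \<and> v (int i) > v (int i + 1)}" for v :: "int \<Rightarrow> int"
  have fin: "finite (D v)" for v unfolding D_def by (rule finite_subset[of _ "{..<n}"]) auto
  have maj: "maj n v = \<Sum>(D v)" for v by (simp add: maj_def D_def)
  have less: "u (int i) < int n" if "1 \<le> i" "i \<le> n" "i \<noteq> m" for i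
    using rng[OF that(1,2)] top[of i] that(3) by linarith
  have Suc_top: "u (int i + 1) = int n \<longleftrightarrow> Suc i = m" for i using top[of "Suc i"] by (simp add: add.commute)
  have Suc_rng: "1 \<le> u (int i + 1) \<and> u (int i + 1) \<le> int n" if "i < n" for i
    using rng[of "Suc i"] that by (simp add: add.commute)
  have rotD: "cycle_up n (u (int i)) > cycle_up n (u (int i + 1)) \<longleftrightarrow>
      (if i = m then False else if Suc i = m then True else u (int i) > u (int i + 1))"
    if "1 \<le> i" "i < n" for i
    using rng[of i] Suc_rng[of i] top[of i] Suc_top[of i] that unfolding cycle_up_def by auto
  have uD: "u (int i) > u (int i + 1) \<longleftrightarrow> 
      (if i = m then True else if Suc i = m then False else u (int i) > u (int i + 1))"
    if "1 \<le> i" "i < n" for i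
    using rng[of i] Suc_rng[of i] top[of i] Suc_top[of i] that by auto
  define K where "K = D u - {m}"
  have Du: "D u = insert m K"
    using uD[of m] pm unfolding K_def D_def by auto
  have Dr: "D (cycle_up n \<circ> u) = K \<union> ({m - 1} - {0})"
    using rotD uD rotD[of "m - 1"] pm unfolding K_def D_def by (auto split: if_splits simp: of_nat_diff)
  have mK: "m \<notin> K" "m - 1 \<notin> K"
    using uD[of "m - 1"] pm unfolding K_def D_def by (auto split: if_splits)
  have "finite K" using fin by (simp add: K_def)
  have "\<Sum>(D u) = m + \<Sum>K" using Du mK \<open>finite K\<close> by simp
  moreover have "\<Sum>(D (cycle_up n \<circ> u)) = m - 1 + \<Sum>K"
  proof (cases "m = 1")
    case False
    hence "K \<union> ({m - 1} - {0}) = insert (m - 1) K" using pm by auto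
    thus ?thesis unfolding Dr using mK \<open>finite K\<close> by simp
  qed (simp add: Dr)
  ultimately show ?thesis using pm by (simp add: maj)
qed

text \<open>The largest value, at position \<open>p\<close>, forms \<open>n - p\<close> inversions; turned into the smallest one it
  forms \<open>p - 1\<close>. All other inversions stay, so the parity changes by \<open>n - 1\<close>. This is the sign
  of an \<open>n\<close>-cycle; taking \<open>e\<close> to be any square root of \<open>1\<close> treats the trivial character together
  with the sign character.\<close>

lemma sign_inv_cycle_up:
  fixes e :: "'a::comm_ring_1"
  assumes u: "u permutes {1..int n}" and n: "n \<ge> 1" and e: "e * e = 1"
  shows "e ^ inv_num n u = e ^ (n - 1) * e ^ inv_num n (cycle_up n \<circ> u)"
proof -
  obtain p where p: "p \<in> {1..int n}" "u p = int n"
    using permutes_image[OF u] n by (metis atLeastAtMost_iff imageE of_nat_1 of_nat_le_iff order_refl)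
  define K where "K = {(i, j). 1 \<le> i \<and> i < j \<and> j \<le> int n \<and> u i > u j \<and> i \<noteq> p \<and> j \<noteq> p}"
  have rng: "1 \<le> u i \<and> u i \<le> int n" if "1 \<le> i" "i \<le> int n" for i
    using permutes_in_image[OF u, of i] that by auto
  have top: "u i = int n \<longleftrightarrow> i = p" for i
    using permutes_inj[OF u] p(2) by (metis inj_eq)
  have "finite K" unfolding K_def
    by (rule finite_subset[of _ "{1..int n} \<times> {1..int n}"]) auto
  have lessn: "u j < int n" if "1 \<le> j" "j \<le> int n" "j \<noteq> p" for j
    using rng[OF that(1,2)] top[of j] that(3) by linarith
  have 1: "{(i, j). 1 \<le> i \<and> i < j \<and> j \<le> int n \<and> u i > u j} = K \<union> Pair p ` {p<..int n}"
    using p rng lessn unfolding K_def by force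
  have "\<And>i j. 1 \<le> i \<Longrightarrow> i < j \<Longrightarrow> j \<le> int n \<Longrightarrow> cycle_up n (u i) > cycle_up n (u j) \<longleftrightarrow>
     (if i = p then False else if j = p then True else u i > u j)"
  proof -
    fix i j :: int assume a: "1 \<le> i" "i < j" "j \<le> int n"
    show "cycle_up n (u i) > cycle_up n (u j) \<longleftrightarrow>
     (if i = p then False else if j = p then True else u i > u j)"
      using rng[of i] rng[of j] top[of i] top[of j] a unfolding cycle_up_def by auto
  qed
  hence 2: "{(i, j). 1 \<le> i \<and> i < j \<and> j \<le> int n \<and> (cycle_up n \<circ> u) i > (cycle_up n \<circ> u) j}
      = K \<union> (\<lambda>i. (i, p)) ` {1..<p}"
    using p(1) unfolding K_def by (auto split: if_splits)
  have c1: "inv_num n u = card K + nat (int n - p)"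
    unfolding inv_num_def 1 using \<open>finite K\<close>
    by (subst card_Un_disjoint) (auto simp: K_def card_image inj_on_def)
  have c2: "inv_num n (cycle_up n \<circ> u) = card K + nat (p - 1)"
    unfolding inv_num_def 2 using \<open>finite K\<close>
    by (subst card_Un_disjoint) (auto simp: K_def card_image inj_on_def)
  have "inv_num n u + (n - 1 + inv_num n (cycle_up n \<circ> u)) = 2 * (n - 1 + card K)"
    using p(1) by (simp add: c1 c2) linarith
  hence "e ^ inv_num n u = e ^ (n - 1 + inv_num n (cycle_up n \<circ> u))"
    by (intro power_cong_parity[OF e]) (metis dvd_triv_left)
  thus ?thesis by (simp add: power_add)
qed

text \<open>For \<open>e = 1\<close> this is MacMahon's formula for \<open>maj\<close>, for \<open>e = -1\<close> the formula of Gessel and Simion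
  for its signed version. Classify the permutations of \<open>1, \<dots>, n\<close> by their last value \<open>v\<close>. As
  long as \<open>v < n\<close>, the shift is a bijection from last value \<open>v\<close> to last value \<open>v + 1\<close> that
  removes a factor \<open>r = e ^ (n - 1) * q\<close> from the weight. So the class of \<open>v\<close> contributes
  \<open>r ^ (n - v)\<close> times the class of \<open>n\<close>, which consists of the permutations of
  \<open>1, \<dots>, n - 1\<close>, and the powers of \<open>r\<close> add up to the factor \<open>[n]\<^sub>r\<close>.\<close>

lemma sum_perms_inv_maj:
  fixes q e :: "'a::comm_ring_1"
  assumes e: "e * e = 1"
  shows "(\<Sum>w | w permutes {1..int n}. e ^ inv_num n w * q ^ maj n w)
    = (\<Prod>k=1..n. qbracket k (e ^ (k - 1) * q))"
proof (induction n)
  case 0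
  have "{(i, j). 1 \<le> i \<and> i < j \<and> j \<le> int 0 \<and> w i > w j} = {}" for w :: "int \<Rightarrow> int"
    by auto
  hence "inv_num 0 w = 0" for w by (simp only: inv_num_def card.empty)
  thus ?case by (simp add: maj_def)
next
  case (Suc n)
  define N where "N = Suc n"
  define wt where "wt w = e ^ inv_num N w * q ^ maj N w" for w
  define S where "S v = {w. w permutes {1..int N} \<and> w (int N) = v}" for v
  define r where "r = e ^ n * q"
  have rp: "cycle_up N permutes {1..int N}" by (rule cycle_up_permutes) (simp add: N_def)
  have step: "sum wt (S v) = r * sum wt (S (v + 1))" if v: "1 \<le> v" "v < int N" for v
  proof -
    have rv: "cycle_up N v = v + 1" using v by (simp add: cycle_up_def)
    have "r * sum wt (S (v + 1)) = (\<Sum>w\<in>S (v + 1). r * wt w)" by (rule sum_distrib_left)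
    also have "\<dots> = sum wt (S v)"
    proof (rule sum.reindex_bij_witness[where i = "\<lambda>w. cycle_up N \<circ> w" and j = "\<lambda>w. inv (cycle_up N) \<circ> w"])
      fix w assume w: "w \<in> S (v + 1)"
      show cancel: "cycle_up N \<circ> (inv (cycle_up N) \<circ> w) = w"
        by (simp add: o_assoc permutes_inv_o(1)[OF rp])
      show mem: "inv (cycle_up N) \<circ> w \<in> S v"
        using w rv permutes_inverses(2)[OF rp, of v] permutes_compose[OF _ permutes_inv[OF rp]]
        unfolding S_def by auto
      have *: "maj N (inv (cycle_up N) \<circ> w) = Suc (maj N (cycle_up N \<circ> (inv (cycle_up N) \<circ> w)))"
        by (rule maj_cycle_up) (use mem v in \<open>auto simp: S_def\<close>)
      have **: "e ^ inv_num N (inv (cycle_up N) \<circ> w)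
          = e ^ (N - 1) * e ^ inv_num N (cycle_up N \<circ> (inv (cycle_up N) \<circ> w))"
        by (rule sign_inv_cycle_up) (use mem v e in \<open>auto simp: S_def N_def\<close>)
      show "wt (inv (cycle_up N) \<circ> w) = r * wt w"
        using *[unfolded cancel] **[unfolded cancel] unfolding wt_def r_def
        by (simp add: N_def mult_ac)
    next
      fix w assume w: "w \<in> S v"
      show "inv (cycle_up N) \<circ> (cycle_up N \<circ> w) = w"
        by (simp add: o_assoc permutes_inv_o(2)[OF rp])
      show "cycle_up N \<circ> w \<in> S (v + 1)"
        using w rv permutes_compose[OF _ rp] unfolding S_def by auto
    qed
    finally show ?thesis by simp
  qed
  have iter: "sum wt (S (int (N - k))) = r ^ k * sum wt (S (int N))" if "k < N" for k
    using that
  proof (induction k)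
    case (Suc k)
    have "int (N - Suc k) + 1 = int (N - k)" using Suc.prems by linarith
    thus ?case using step[of "int (N - Suc k)"] Suc by (simp add: mult.assoc)
  qed simp
  have SN: "S (int N) = {w. w permutes {1..int n}}"
  proof (intro equalityI subsetI)
    fix w assume "w \<in> S (int N)"
    hence w: "w permutes {1..int N}" "w (int N) = int N" by (auto simp: S_def)
    have "w permutes ({1..int N} - {int N})"
      by (rule permutes_superset[OF w(1)]) (use w in auto)
    moreover have "{1..int N} - {int N} = {1..int n}" by (auto simp: N_def)
    ultimately show "w \<in> {w. w permutes {1..int n}}" by simp
  next
    fix w assume w: "w \<in> {w. w permutes {1..int n}}"
    hence "w permutes {1..int N}" by (auto intro: permutes_subset simp: N_def)
    moreover have "w (int N) = int N" using w by (auto simp: N_def permutes_not_in)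
    ultimately show "w \<in> S (int N)" by (simp add: S_def)
  qed
  \<comment> \<open>A largest value in the last position takes part in no inversion and no descent.\<close>
  have wt_restrict: "wt w = e ^ inv_num n w * q ^ maj n w" if "w permutes {1..int n}" for w
  proof -
    have top: "w (1 + int n) = 1 + int n" using that by (auto simp: permutes_not_in)
    have rng: "w i \<le> int n" if "1 \<le> i" "i \<le> int n" for i
      using permutes_in_image[OF \<open>w permutes _\<close>, of i] that by auto
    have "{(i, j). 1 \<le> i \<and> i < j \<and> j \<le> int N \<and> w i > w j}
        = {(i, j). 1 \<le> i \<and> i < j \<and> j \<le> int n \<and> w i > w j}"
    proof -
      have "j \<le> int n" if "1 \<le> i" "i < j" "j \<le> int N" "w i > w j" for i j
        using that rng[of i] top by (cases "j = 1 + int n") (auto simp: N_def)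
      thus ?thesis by (auto simp: N_def)
    qed
    moreover have "{i. 1 \<le> i \<and> i < N \<and> w (int i) > w (int i + 1)}
        = {i. 1 \<le> i \<and> i < n \<and> w (int i) > w (int i + 1)}"
    proof -
      have "i \<noteq> n" if "1 \<le> i" "w (int i) > w (int i + 1)" for i
        using that rng[of "int i"] top by (auto simp: add.commute)
      thus ?thesis by (force simp: N_def)
    qed
    ultimately show ?thesis by (simp add: wt_def inv_num_def maj_def)
  qed
  \<comment> \<open>The fibres are indexed by the number of shifts that bring the last value to the top.\<close>
  have "sum wt {w. w permutes {1..int N}} = (\<Sum>k<N. sum wt {w \<in> {w. w permutes {1..int N}}. nat (int N - w (int N)) = k})"
  proof (rule sum.group[symmetric])
    show "finite {w. w permutes {1..int N}}" by (simp add: finite_permutations)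
    show "(\<lambda>w. nat (int N - w (int N))) ` {w. w permutes {1..int N}} \<subseteq> {..<N}"
    proof (rule image_subsetI)
      fix w assume "w \<in> {w. w permutes {1..int N}}"
      hence "w permutes {1..int N}" by simp
      from permutes_in_image[OF this, of "int N"]
      show "nat (int N - w (int N)) \<in> {..<N}" by (auto simp: N_def)
    qed
  qed simp
  also have "\<dots> = (\<Sum>k<N. sum wt (S (int (N - k))))"
  proof (rule sum.cong[OF refl])
    fix k assume "k \<in> {..<N}"
    have "{w \<in> {w. w permutes {1..int N}}. nat (int N - w (int N)) = k} = S (int (N - k))"
    proof -
      have "nat (int N - w (int N)) = k \<longleftrightarrow> w (int N) = int (N - k)" if "w permutes {1..int N}" for w
        using permutes_in_image[OF that, of "int N"] \<open>k \<in> {..<N}\<close> by (auto simp: N_def)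
      thus ?thesis unfolding S_def by auto
    qed
    thus "sum wt {w \<in> {w. w permutes {1..int N}}. nat (int N - w (int N)) = k} = sum wt (S (int (N - k)))" by simp
  qed
  also have "\<dots> = (\<Sum>k<N. r ^ k * sum wt (S (int N)))"
    using iter by (intro sum.cong) auto
  also have "\<dots> = qbracket N r * sum wt (S (int N))" by (simp add: qbracket_def sum_distrib_right)
  also have "sum wt (S (int N)) = (\<Prod>k=1..n. qbracket k (e ^ (k - 1) * q))"
    unfolding SN Suc.IH[symmetric] by (intro sum.cong) (auto simp: wt_restrict)
  finally show ?case by (simp add: wt_def N_def r_def mult.commute)
qed

section \<open>Signed permutations with a prescribed set of negated values\<close>

definition rank_in :: "int set \<Rightarrow> int \<Rightarrow> int" where
  "rank_in V x = int (card {y \<in> V. y \<le> x})"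

lemma rank_in_less_iff:
  assumes "finite V" "x \<in> V" "y \<in> V"
  shows "rank_in V x < rank_in V y \<longleftrightarrow> x < y"
proof -
  have mono: "rank_in V a \<le> rank_in V b" if "a \<le> b" for a b
    unfolding rank_in_def using assms(1) that by (auto intro!: card_mono)
  have strict: "rank_in V x < rank_in V y" if "x < y"
  proof -
    have "{z \<in> V. z \<le> x} \<subset> {z \<in> V. z \<le> y}" using that assms(3) by force
    thus ?thesis unfolding rank_in_def using assms(1) by (simp add: psubset_card_mono)
  qed
  show ?thesis using strict mono[of y x] by linarith
qed

lemma bij_betw_rank_in:
  assumes V: "finite V"
  shows "bij_betw (rank_in V) V {1..int (card V)}"
proof -
  have inj: "inj_on (rank_in V) V"
    by (rule inj_onI) (metis V less_irrefl linorder_neqE rank_in_less_iff)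
  have sub: "rank_in V ` V \<subseteq> {1..int (card V)}"
  proof clarify
    fix x assume "x \<in> V"
    have "card {y \<in> V. y \<le> x} \<noteq> 0" using V \<open>x \<in> V\<close> by auto
    moreover have "card {y \<in> V. y \<le> x} \<le> card V" using V by (auto intro: card_mono)
    ultimately show "rank_in V x \<in> {1..int (card V)}" by (auto simp: rank_in_def)
  qed
  have "rank_in V ` V = {1..int (card V)}"
    by (rule card_subset_eq) (use sub inj in \<open>auto simp: card_image\<close>)
  with inj show ?thesis by (simp add: bij_betw_def)
qed

lemma inv_num_cong:
  assumes "\<And>i j. i \<in> {1..int n} \<Longrightarrow> j \<in> {1..int n} \<Longrightarrow> f i < f j \<longleftrightarrow> g i < g j"
  shows "inv_num n f = inv_num n g"
proof -
  have "{(i, j). 1 \<le> i \<and> i < j \<and> j \<le> int n \<and> f i > f j}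
      = {(i, j). 1 \<le> i \<and> i < j \<and> j \<le> int n \<and> g i > g j}"
    using assms by auto
  thus ?thesis by (simp add: inv_num_def)
qed

lemma maj_cong:
  assumes "\<And>i j. i \<in> {1..int n} \<Longrightarrow> j \<in> {1..int n} \<Longrightarrow> f i < f j \<longleftrightarrow> g i < g j"
  shows "maj n f = maj n g"
proof -
  have "{i. 1 \<le> i \<and> i < n \<and> f (int i) > f (int i + 1)}
      = {i. 1 \<le> i \<and> i < n \<and> g (int i) > g (int i + 1)}"
    using assms by auto
  thus ?thesis by (simp add: maj_def)
qed

definition Negval :: "nat \<Rightarrow> (int \<Rightarrow> int) \<Rightarrow> int set" where
  "Negval n \<pi> = (\<lambda>i. - \<pi> i) ` Neg n \<pi>"

text \<open>The values on positive positions of a signed permutation that negates exactly the values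
  in \<open>J\<close>.\<close>

definition signed_values :: "nat \<Rightarrow> int set \<Rightarrow> int set" where
  "signed_values n J = uminus ` J \<union> ({1..int n} - J)"

lemma signed_perms_abs_range:
  assumes "\<pi> \<in> signed_perms n" "i \<in> {1..int n}"
  shows "\<bar>\<pi> i\<bar> \<in> {1..int n}"
proof -
  have "i \<in> signed_ground n" using assms(2) by (auto simp: signed_ground_def)
  hence "\<pi> i \<in> signed_ground n" using assms(1) by (simp add: signed_perms_def permutes_in_image)
  thus ?thesis by (auto simp: signed_ground_def)
qed

lemma signed_perms_neg: "\<pi> \<in> signed_perms n \<Longrightarrow> \<pi> (- i) = - \<pi> i"
proof (cases "i \<in> signed_ground n")
  case False
  assume "\<pi> \<in> signed_perms n"
  moreover have "- i \<notin> signed_ground n" using False by (auto simp: signed_ground_def)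
  ultimately show ?thesis using False by (auto simp: signed_perms_def permutes_not_in)
qed (auto simp: signed_perms_def)

lemma signed_perms_inj: "\<pi> \<in> signed_perms n \<Longrightarrow> \<pi> i = \<pi> j \<longleftrightarrow> i = j"
  by (auto simp: signed_perms_def dest!: permutes_inj injD)

lemma signed_perms_abs_inj:
  assumes "\<pi> \<in> signed_perms n" "i > 0" "j > 0"
  shows "\<bar>\<pi> i\<bar> = \<bar>\<pi> j\<bar> \<longleftrightarrow> i = j"
proof
  assume "\<bar>\<pi> i\<bar> = \<bar>\<pi> j\<bar>"
  hence "\<pi> i = \<pi> j \<or> \<pi> i = \<pi> (- j)" by (auto simp: signed_perms_neg[OF assms(1)] abs_eq_iff)
  thus "i = j" using assms by (auto simp: signed_perms_inj[OF assms(1)])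
qed simp

lemma signed_perms_surj:
  assumes \<pi>: "\<pi> \<in> signed_perms n" and v: "v \<in> {1..int n}"
  obtains i where "i \<in> {1..int n}" "\<bar>\<pi> i\<bar> = v"
proof -
  have p: "\<pi> permutes signed_ground n" using \<pi> by (simp add: signed_perms_def)
  have "v \<in> signed_ground n" using v by (auto simp: signed_ground_def)
  then obtain j where j: "j \<in> signed_ground n" "\<pi> j = v"
    using permutes_image[OF p] by (metis imageE)
  have "\<bar>j\<bar> \<in> {1..int n}" using j(1) by (auto simp: signed_ground_def)
  moreover have "\<bar>\<pi> \<bar>j\<bar>\<bar> = v" using j(2) v by (auto simp: abs_if signed_perms_neg[OF \<pi>])
  ultimately show ?thesis by (rule that)
qed

lemma Negval_subset: "\<pi> \<in> signed_perms n \<Longrightarrow> Negval n \<pi> \<subseteq> {1..int n}"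
  using signed_perms_abs_range by (fastforce simp: Negval_def Neg_def)

lemma signed_perms_bij_signed_values:
  assumes \<pi>: "\<pi> \<in> signed_perms n"
  shows "bij_betw \<pi> {1..int n} (signed_values n (Negval n \<pi>))"
proof -
  have "\<pi> ` {1..int n} = signed_values n (Negval n \<pi>)"
  proof (intro equalityI subsetI)
    fix v assume "v \<in> \<pi> ` {1..int n}"
    then obtain i where i: "i \<in> {1..int n}" "v = \<pi> i" by auto
    show "v \<in> signed_values n (Negval n \<pi>)"
    proof (cases "v < 0")
      case True
      hence "- v \<in> Negval n \<pi>" using i by (auto simp: Negval_def Neg_def)
      thus ?thesis unfolding signed_values_def by (metis UnI1 add.inverse_inverse imageI)
    next
      case False
      hence "v \<in> {1..int n}" using signed_perms_abs_range[OF \<pi> i(1)] i(2) by auto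
      moreover have "v \<notin> Negval n \<pi>"
      proof
        assume "v \<in> Negval n \<pi>"
        then obtain j where j: "j \<in> Neg n \<pi>" "v = - \<pi> j" by (auto simp: Negval_def)
        have "\<bar>\<pi> i\<bar> = \<bar>\<pi> j\<bar>" using i(2) j(2) by linarith
        hence "i = j" using signed_perms_abs_inj[OF \<pi>, of i j] i(1) j(1) by (simp add: Neg_def)
        hence "v = \<pi> j" using i(2) by blast
        moreover have "\<pi> j < 0" using j(1) by (simp add: Neg_def)
        ultimately show False using j(2) by linarith
      qed
      ultimately show ?thesis by (simp add: signed_values_def)
    qed
  next
    fix v assume v: "v \<in> signed_values n (Negval n \<pi>)"
    show "v \<in> \<pi> ` {1..int n}"
    proof (cases "v \<in> uminus ` Negval n \<pi>")
      case True
      thus ?thesis by (auto simp: Negval_def Neg_def)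
    next
      case False
      hence v: "v \<in> {1..int n}" "v \<notin> Negval n \<pi>" using v by (auto simp: signed_values_def)
      obtain i where i: "i \<in> {1..int n}" "\<bar>\<pi> i\<bar> = v" by (rule signed_perms_surj[OF \<pi> v(1)])
      have "\<pi> i \<ge> 0"
      proof (rule ccontr)
        assume "\<not> 0 \<le> \<pi> i"
        hence "v \<in> Negval n \<pi>" using i by (auto simp: Negval_def Neg_def image_iff)
        thus False using v(2) by simp
      qed
      thus ?thesis using i by auto
    qed
  qed
  thus ?thesis using signed_perms_inj[OF \<pi>] by (auto simp: bij_betw_def inj_on_def)
qed

text \<open>The extension of a word on the positions \<open>1, \<dots>, n\<close> to an odd function; being the identity
  elsewhere, as signed permutations are by convention.\<close>

definition odd_ext :: "nat \<Rightarrow> (int \<Rightarrow> int) \<Rightarrow> int \<Rightarrow> int" where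
  "odd_ext n f i = (if i \<in> {1..int n} then f i else if - i \<in> {1..int n} then - f (- i) else i)"

lemma
  assumes f: "bij_betw f {1..int n} (signed_values n J)" and J: "J \<subseteq> {1..int n}"
  shows odd_ext_signed_perms: "odd_ext n f \<in> signed_perms n"
    and Negval_odd_ext: "Negval n (odd_ext n f) = J"
proof -
  have ground: "signed_ground n = {1..int n} \<union> uminus ` {1..int n}"
    by (auto simp: signed_ground_def)
  have fi: "f ` {1..int n} = signed_values n J" using f by (simp add: bij_betw_def)
  have odd: "odd_ext n f (- i) = - odd_ext n f i" for i by (auto simp: odd_ext_def)
  have "odd_ext n f ` {1..int n} = signed_values n J"
    unfolding fi[symmetric] by (intro image_cong) (auto simp: odd_ext_def)
  moreover have "odd_ext n f ` uminus ` {1..int n} = uminus ` odd_ext n f ` {1..int n}"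
    unfolding image_image odd ..
  ultimately have "odd_ext n f ` signed_ground n = signed_values n J \<union> uminus ` signed_values n J"
    by (simp add: ground image_Un)
  also have "\<dots> = signed_ground n" 
  proof -
    have "x \<in> uminus ` A \<longleftrightarrow> - x \<in> A" for x :: int and A
      by (force simp: image_iff)
    thus ?thesis using J unfolding signed_values_def by (auto simp: signed_ground_def)
  qed
  finally have im: "odd_ext n f ` signed_ground n = signed_ground n" .
  have fin: "finite (signed_ground n)" by (simp add: signed_ground_def)
  \<comment> \<open>A surjection of a finite set onto itself is injective.\<close>
  have "bij_betw (odd_ext n f) (signed_ground n) (signed_ground n)"
    unfolding bij_betw_def using im fin by (auto intro: eq_card_imp_inj_on)
  hence "odd_ext n f permutes signed_ground n"
    by (rule bij_imp_permutes) (auto simp: odd_ext_def signed_ground_def)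
  thus "odd_ext n f \<in> signed_perms n" by (simp add: signed_perms_def odd)
  show "Negval n (odd_ext n f) = J"
  proof (intro equalityI subsetI)
    fix v assume "v \<in> Negval n (odd_ext n f)"
    then obtain i where i: "i \<in> {1..int n}" "f i < 0" "v = - f i"
      by (auto simp: Negval_def Neg_def odd_ext_def)
    moreover have "f i \<in> signed_values n J" using fi i by blast
    ultimately show "v \<in> J" by (auto simp: signed_values_def)
  next
    fix v assume v: "v \<in> J"
    hence "- v \<in> signed_values n J" by (simp add: signed_values_def)
    then obtain i where "i \<in> {1..int n}" "- v = f i" unfolding fi[symmetric] by blast
    moreover have "v > 0" using v J by auto
    ultimately show "v \<in> Negval n (odd_ext n f)"
      unfolding Negval_def by (intro image_eqI[of _ _ i]) (auto simp: Neg_def odd_ext_def)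
  qed
qed

lemma card_signed_values:
  assumes J: "J \<subseteq> {1..int n}"
  shows "finite (signed_values n J)" "card (signed_values n J) = n"
proof -
  have fin: "finite J" using J finite_subset by blast
  thus "finite (signed_values n J)" by (simp add: signed_values_def)
  have "card (signed_values n J) = card (uminus ` J) + card ({1..int n} - J)"
    unfolding signed_values_def using fin J by (intro card_Un_disjoint) auto
  also have "\<dots> = n"
    using J fin card_mono[OF _ J] by (simp add: card_image card_Diff_subset)
  finally show "card (signed_values n J) = n" .
qed

text \<open>The weight splits into a part that depends only on the set \<open>J\<close> of negated values and a part that
  depends only on the relative order of the values. For fixed \<open>J\<close> the set of values is
  \<open>signed_values n J\<close>; replacing each value by its rank (standardization) identifies the signed
  permutations with the ordinary ones and preserves inversions and descents. So every \<open>J\<close>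
  contributes the same sum over permutations, times a product over \<open>J\<close>; summing these products
  over all \<open>J\<close> gives the expansion of \<open>\<Prod>k. 1 + y k\<close>.\<close>

lemma sum_signed_perms_inv_maj:
  fixes q e :: "'a::comm_ring_1" and y :: "nat \<Rightarrow> 'a"
  assumes e: "e * e = 1"
  shows "(\<Sum>\<pi>\<in>signed_perms n. e ^ inv_num n \<pi> * (\<Prod>j\<in>Negval n \<pi>. y (nat j)) * q ^ maj n \<pi>)
    = (\<Prod>k=1..n. (1 + y k) * qbracket k (e ^ (k - 1) * q))"
proof -
  define P where "P = (\<Prod>k=1..n. qbracket k (e ^ (k - 1) * q))"
  define wt where "wt \<pi> = e ^ inv_num n \<pi> * (\<Prod>j\<in>Negval n \<pi>. y (nat j)) * q ^ maj n \<pi>" for \<pi>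
  have fibre: "sum wt {\<pi> \<in> signed_perms n. Negval n \<pi> = J} = (\<Prod>j\<in>J. y (nat j)) * P"
    if J: "J \<subseteq> {1..int n}" for J
  proof -
    let ?V = "signed_values n J"
    let ?S = "rank_in ?V"
    define T where "T = inv_into ?V ?S"
    note V = card_signed_values[OF J]
    have S: "bij_betw ?S ?V {1..int n}" using bij_betw_rank_in[OF V(1)] V(2) by simp
    have T: "bij_betw T {1..int n} ?V" unfolding T_def by (rule bij_betw_inv_into[OF S])
    have ST: "?S (T i) = i" if "i \<in> {1..int n}" for i
      unfolding T_def using S that by (simp add: bij_betw_inv_into_right)
    have TS: "T (?S v) = v" if "v \<in> ?V" for v
      unfolding T_def using S that by (simp add: bij_betw_inv_into_left)
    have "sum wt {\<pi> \<in> signed_perms n. Negval n \<pi> = J}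
        = (\<Sum>w | w permutes {1..int n}. (\<Prod>j\<in>J. y (nat j)) * (e ^ inv_num n w * q ^ maj n w))"
    proof (rule sum.reindex_bij_witness[where i = "\<lambda>w. odd_ext n (T \<circ> w)"
            and j = "\<lambda>\<pi> i. if i \<in> {1..int n} then ?S (\<pi> i) else i"])
      fix \<pi> assume "\<pi> \<in> {\<pi> \<in> signed_perms n. Negval n \<pi> = J}"
      hence \<pi>: "\<pi> \<in> signed_perms n" and N: "Negval n \<pi> = J" by auto
      have b: "bij_betw \<pi> {1..int n} ?V" using signed_perms_bij_signed_values[OF \<pi>] N by simp
      have inV: "\<pi> i \<in> ?V" if "i \<in> {1..int n}" for i using b that by (auto dest: bij_betwE)
      define w where "w = (\<lambda>i. if i \<in> {1..int n} then ?S (\<pi> i) else i)"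
      have "bij_betw (?S \<circ> \<pi>) {1..int n} {1..int n}" by (rule bij_betw_trans[OF b S])
      hence "bij_betw w {1..int n} {1..int n}"
        by (rule bij_betw_cong[THEN iffD1, rotated]) (auto simp: w_def)
      hence w: "w permutes {1..int n}"
        by (rule bij_imp_permutes) (simp only: w_def if_False)
      thus "w \<in> {w. w permutes {1..int n}}" by simp
      show "odd_ext n (T \<circ> w) = \<pi>"
      proof
        fix i
        have "\<pi> i = i" if "i \<notin> {1..int n}" "- i \<notin> {1..int n}"
        proof -
          have "i \<notin> signed_ground n" using that by (auto simp: signed_ground_def)
          thus ?thesis using \<pi> by (auto simp: signed_perms_def permutes_not_in)
        qed
        moreover have "\<pi> (- i) = - \<pi> i" by (rule signed_perms_neg[OF \<pi>])
        ultimately show "odd_ext n (T \<circ> w) i = \<pi> i"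
          using TS[OF inV, of i] TS[OF inV, of "- i"] unfolding odd_ext_def w_def comp_def
          by simp
      qed
      have ord: "w i < w j \<longleftrightarrow> \<pi> i < \<pi> j" if "i \<in> {1..int n}" "j \<in> {1..int n}" for i j
        using that rank_in_less_iff[OF V(1) inV inV] by (simp only: w_def if_True)
      show "(\<Prod>j\<in>J. y (nat j)) * (e ^ inv_num n w * q ^ maj n w) = wt \<pi>"
        using inv_num_cong[of n w \<pi>, OF ord] maj_cong[of n w \<pi>, OF ord]
        by (simp add: wt_def N)
    next
      fix w assume "w \<in> {w. w permutes {1..int n}}"
      hence w: "w permutes {1..int n}" by simp
      have b: "bij_betw (T \<circ> w) {1..int n} ?V"
        by (rule bij_betw_trans[OF permutes_imp_bij[OF w] T])
      show "odd_ext n (T \<circ> w) \<in> {\<pi> \<in> signed_perms n. Negval n \<pi> = J}"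
        using odd_ext_signed_perms[OF b J] Negval_odd_ext[OF b J] by simp
      show "(\<lambda>i. if i \<in> {1..int n} then ?S (odd_ext n (T \<circ> w) i) else i) = w"
      proof
        fix i
        show "(if i \<in> {1..int n} then ?S (odd_ext n (T \<circ> w) i) else i) = w i"
        proof (cases "i \<in> {1..int n}")
          case True
          thus ?thesis using ST[of "w i"] permutes_in_image[OF w, of i] by (simp add: odd_ext_def)
        next
          case False
          thus ?thesis using permutes_not_in[OF w False] by (simp only: if_False)
        qed
      qed
    qed
    thus ?thesis by (simp add: sum_distrib_left[symmetric] sum_perms_inv_maj[OF e] P_def)
  qed
  have "sum wt (signed_perms n)
      = (\<Sum>J\<in>Pow {1..int n}. sum wt {\<pi> \<in> signed_perms n. Negval n \<pi> = J})"
    by (rule sum.group[symmetric]) (auto simp: finite_signed_perms dest: Negval_subset)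
  also have "\<dots> = (\<Sum>J\<in>Pow {1..int n}. \<Prod>j\<in>J. y (nat j)) * P"
    by (simp add: fibre sum_distrib_right)
  also have "(\<Sum>J\<in>Pow {1..int n}. \<Prod>j\<in>J. y (nat j)) = (\<Prod>j\<in>{1..int n}. y (nat j) + 1)"
    by (subst prod_add) auto
  also have "\<dots> = (\<Prod>k=1..n. 1 + y k)"
    by (rule prod.reindex_bij_witness[of _ int nat]) (auto simp: add.commute)
  finally show ?thesis by (simp add: wt_def P_def prod.distrib)
qed

section \<open>Inversions of the underlying permutation\<close>

lemma even_card_sym_diff:
  assumes "finite B" "finite C" and A: "\<And>x. x \<in> A \<longleftrightarrow> (x \<in> B) \<noteq> (x \<in> C)"
  shows "even (card A + card B + card C)"
proof -
  have "card B = card (B \<inter> C) + card (B - C)" "card C = card (C \<inter> B) + card (C - B)"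
    using assms(1,2) by (simp_all add: card_Int_Diff)
  moreover have "A = (B - C) \<union> (C - B)" using A by auto
  hence "card A = card (B - C) + card (C - B)"
    by (simp only:) (rule card_Un_disjoint, use assms(1,2) in auto)
  ultimately show ?thesis unfolding Int_commute[of C B] by presburger
qed

lemma odd_card_toggle:
  assumes "finite B" and "\<And>y. y \<in> A \<longleftrightarrow> (y \<in> B) \<noteq> (y = x)"
  shows "odd (card A + card B)"
  using even_card_sym_diff[of B "{x}" A] assms by auto

text \<open>Consider a pair of positions and the one of them whose value has the larger absolute value. If that
  value is positive, passing to absolute values keeps the order of the two values; if it is
  negative, the order is reversed. So the two inversion numbers differ in parity by the number of
  pairs in which the value of larger absolute value is negative, and a negated value \<open>j\<close> dominates
  exactly \<open>j - 1\<close> others.\<close>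

lemma minus_one_inv_abs_perm:
  assumes \<pi>: "\<pi> \<in> signed_perms n"
  shows "(-1 :: 'a::comm_ring_1) ^ inv_num n (abs_perm n \<pi>)
    = (-1) ^ inv_num n \<pi> * (\<Prod>j\<in>Negval n \<pi>. (-1) ^ (nat j - 1))"
proof -
  define X where "X = {(i, j). 1 \<le> i \<and> i < j \<and> j \<le> int n}"
  define A where "A = {(i, j) \<in> X. \<bar>\<pi> i\<bar> > \<bar>\<pi> j\<bar>}"
  define B where "B = {(i, j) \<in> X. \<pi> i > \<pi> j}"
  define C where "C = {(i, j) \<in> X. if \<bar>\<pi> i\<bar> < \<bar>\<pi> j\<bar> then \<pi> j < 0 else \<pi> i < 0}"
  have fin: "finite X" unfolding X_def
    by (rule finite_subset[of _ "{1..int n} \<times> {1..int n}"]) auto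
  have neq: "\<bar>\<pi> i\<bar> \<noteq> \<bar>\<pi> j\<bar>" if "(i, j) \<in> X" for i j
    using that signed_perms_abs_inj[OF \<pi>, of i j] by (auto simp: X_def)
  have "x \<in> A \<longleftrightarrow> (x \<in> B) \<noteq> (x \<in> C)" for x
  proof (cases x)
    case (Pair i j)
    show ?thesis using neq[of i j] unfolding Pair A_def B_def C_def by auto
  qed
  hence "even (card A + card B + card C)"
    by (intro even_card_sym_diff finite_subset[OF _ fin]) (auto simp: B_def C_def)
  hence "even (card A + (card B + card C))" by (simp add: add.assoc)
  hence AB: "(-1 :: 'a) ^ card A = (-1) ^ card B * (-1) ^ card C"
    unfolding power_add[symmetric] by (intro power_cong_parity) auto
  have "{(i, j). 1 \<le> i \<and> i < j \<and> j \<le> int n \<and> abs_perm n \<pi> i > abs_perm n \<pi> j} = A"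
    by (auto simp: A_def X_def abs_perm_def)
  hence A: "inv_num n (abs_perm n \<pi>) = card A" by (simp add: inv_num_def)
  have "{(i, j). 1 \<le> i \<and> i < j \<and> j \<le> int n \<and> \<pi> i > \<pi> j} = B"
    by (auto simp: B_def X_def)
  hence B: "inv_num n \<pi> = card B" by (simp add: inv_num_def)
  \<comment> \<open>Such pairs are counted with the dominating position first, instead of in increasing order.\<close>
  define D where "D = (SIGMA i:Neg n \<pi>. {j \<in> {1..int n}. \<bar>\<pi> j\<bar> < \<bar>\<pi> i\<bar>})"
  have "bij_betw (\<lambda>(i, j). if \<bar>\<pi> i\<bar> < \<bar>\<pi> j\<bar> then (j, i) else (i, j)) C D"
  proof (rule bij_betw_byWitness[where f' = "\<lambda>(i, j). (min i j, max i j)"])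
    show "(\<lambda>(i, j). if \<bar>\<pi> i\<bar> < \<bar>\<pi> j\<bar> then (j, i) else (i, j)) ` C \<subseteq> D"
    proof (rule image_subsetI, clarify)
      fix i j assume "(i, j) \<in> C"
      thus "(if \<bar>\<pi> i\<bar> < \<bar>\<pi> j\<bar> then (j, i) else (i, j)) \<in> D"
        using neq[of i j] unfolding C_def D_def X_def Neg_def by (auto split: if_splits)
    qed
    show "(\<lambda>(i, j). (min i j, max i j)) ` D \<subseteq> C"
    proof (rule image_subsetI, clarify)
      fix i j assume "(i, j) \<in> D"
      hence "i \<in> {1..int n}" "\<pi> i < 0" "j \<in> {1..int n}" "\<bar>\<pi> j\<bar> < \<bar>\<pi> i\<bar>"
        by (auto simp: D_def Neg_def)
      moreover from this(4) have "i \<noteq> j" by blast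
      ultimately show "(min i j, max i j) \<in> C"
        unfolding C_def X_def by (cases "i < j") (auto simp: min_def max_def)
    qed
    show "\<forall>x\<in>C. (case case x of (i, j) \<Rightarrow> if \<bar>\<pi> i\<bar> < \<bar>\<pi> j\<bar> then (j, i) else (i, j) of
        (i, j) \<Rightarrow> (min i j, max i j)) = x"
      by (auto simp: C_def X_def)
    show "\<forall>x\<in>D. (case case x of (i, j) \<Rightarrow> (min i j, max i j) of
        (i, j) \<Rightarrow> if \<bar>\<pi> i\<bar> < \<bar>\<pi> j\<bar> then (j, i) else (i, j)) = x"
    proof clarify
      fix i j assume "(i, j) \<in> D"
      hence "\<bar>\<pi> j\<bar> < \<bar>\<pi> i\<bar>" "\<not> \<bar>\<pi> i\<bar> < \<bar>\<pi> j\<bar>" by (auto simp: D_def)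
      thus "(if \<bar>\<pi> (min i j)\<bar> < \<bar>\<pi> (max i j)\<bar> then (max i j, min i j) else (min i j, max i j)) = (i, j)"
        by (cases "i \<le> j") (simp_all only: min_def max_def if_True if_False)
    qed
  qed
  hence "card C = card D" by (rule bij_betw_same_card)
  also have "\<dots> = (\<Sum>i\<in>Neg n \<pi>. card {j \<in> {1..int n}. \<bar>\<pi> j\<bar> < \<bar>\<pi> i\<bar>})"
    unfolding D_def Neg_def by (rule card_SigmaI) (auto intro: finite_subset[of _ "{1..int n}"])
  also have "\<dots> = (\<Sum>i\<in>Neg n \<pi>. nat (- \<pi> i) - 1)"
  proof (rule sum.cong[OF refl])
    fix i assume "i \<in> Neg n \<pi>"
    hence i: "i \<in> {1..int n}" "\<bar>\<pi> i\<bar> = - \<pi> i" by (auto simp: Neg_def)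
    have "(\<lambda>j. \<bar>\<pi> j\<bar>) ` {j \<in> {1..int n}. \<bar>\<pi> j\<bar> < \<bar>\<pi> i\<bar>} = {1..<\<bar>\<pi> i\<bar>}"
    proof (intro equalityI subsetI)
      fix v assume v: "v \<in> {1..<\<bar>\<pi> i\<bar>}"
      hence "v \<in> {1..int n}" using signed_perms_abs_range[OF \<pi> i(1)] by auto
      then obtain j where "j \<in> {1..int n}" "\<bar>\<pi> j\<bar> = v" by (rule signed_perms_surj[OF \<pi>])
      thus "v \<in> (\<lambda>j. \<bar>\<pi> j\<bar>) ` {j \<in> {1..int n}. \<bar>\<pi> j\<bar> < \<bar>\<pi> i\<bar>}" using v by auto
    next
      fix v assume "v \<in> (\<lambda>j. \<bar>\<pi> j\<bar>) ` {j \<in> {1..int n}. \<bar>\<pi> j\<bar> < \<bar>\<pi> i\<bar>}"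
      then obtain j where j: "v = \<bar>\<pi> j\<bar>" "j \<in> {1..int n}" "\<bar>\<pi> j\<bar> < \<bar>\<pi> i\<bar>" by blast
      thus "v \<in> {1..<\<bar>\<pi> i\<bar>}" using signed_perms_abs_range[OF \<pi> j(2)] by simp
    qed
    moreover have "inj_on (\<lambda>j. \<bar>\<pi> j\<bar>) {j \<in> {1..int n}. \<bar>\<pi> j\<bar> < \<bar>\<pi> i\<bar>}"
      by (rule inj_onI) (use signed_perms_abs_inj[OF \<pi>] in auto)
    ultimately have "card {j \<in> {1..int n}. \<bar>\<pi> j\<bar> < \<bar>\<pi> i\<bar>} = card {1..<\<bar>\<pi> i\<bar>}"
      by (metis card_image)
    thus "card {j \<in> {1..int n}. \<bar>\<pi> j\<bar> < \<bar>\<pi> i\<bar>} = nat (- \<pi> i) - 1"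
      by (simp add: i(2) nat_diff_distrib')
  qed
  finally have "(-1 :: 'a) ^ card C = (\<Prod>j\<in>Negval n \<pi>. (-1) ^ (nat j - 1))"
    by (simp add: power_sum Negval_def prod.reindex inj_on_def signed_perms_inj[OF \<pi>])
  thus ?thesis by (simp add: AB A B)
qed

section \<open>The parity of the Coxeter length\<close>

lemma B_gen_involution: "B_gen i (B_gen i v) = v"
  by (simp add: B_gen_def transpose_def)

lemma B_gen_signed_perms:
  assumes "i < n"
  shows "B_gen i \<in> signed_perms n"
proof -
  have "B_gen i v \<in> signed_ground n" if "v \<in> signed_ground n" for v
    using that assms by (auto simp: B_gen_def transpose_def signed_ground_def)
  hence "bij_betw (B_gen i) (signed_ground n) (signed_ground n)"
    by (intro bij_betw_byWitness[where f' = "B_gen i"]) (auto simp: B_gen_involution)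
  hence "B_gen i permutes signed_ground n"
    by (rule bij_imp_permutes)
       (use assms in \<open>auto simp: B_gen_def transpose_def signed_ground_def\<close>)
  moreover have "B_gen i (- v) = - B_gen i v" for v
    by (auto simp: B_gen_def transpose_def)
  ultimately show ?thesis by (simp add: signed_perms_def)
qed

lemma signed_perms_compose:
  assumes "\<sigma> \<in> signed_perms n" "\<pi> \<in> signed_perms n"
  shows "\<sigma> \<circ> \<pi> \<in> signed_perms n"
  using assms permutes_compose[of \<pi> _ \<sigma>]
  by (simp add: signed_perms_neg[OF assms(1)] signed_perms_neg[OF assms(2)] signed_perms_def)

text \<open>A number with the parity of the Coxeter length.\<close>

definition length_parity :: "nat \<Rightarrow> (int \<Rightarrow> int) \<Rightarrow> nat" where
  "length_parity n \<pi> = inv_num n (abs_perm n \<pi>) + neg n \<pi>"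

text \<open>Composition on the left acts on values. The generator \<open>s\<^sub>0\<close> changes the sign of the value of absolute
  value \<open>1\<close> and nothing else. For \<open>i \<ge> 1\<close>, the generator \<open>s\<^sub>i\<close> keeps all signs and exchanges the absolute
  values \<open>i\<close> and \<open>i + 1\<close>; since these are neighbours, only the order of that single pair changes.\<close>

lemma odd_length_parity_B_gen:
  assumes \<pi>: "\<pi> \<in> signed_perms n" and i: "i < n"
  shows "odd (length_parity n (B_gen i \<circ> \<pi>) + length_parity n \<pi>)"
proof (cases "i = 0")
  case True
  obtain p where p: "p \<in> {1..int n}" "\<bar>\<pi> p\<bar> = 1"
    using signed_perms_surj[OF \<pi>, of 1] i by auto
  have one: "\<bar>\<pi> j\<bar> = 1 \<longleftrightarrow> j = p" if "j \<in> {1..int n}" for j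
    using signed_perms_abs_inj[OF \<pi>, of j p] that p by auto
  have "\<bar>B_gen 0 v\<bar> = \<bar>v\<bar>" for v by (auto simp: B_gen_def transpose_def)
  hence "abs_perm n (B_gen 0 \<circ> \<pi>) = abs_perm n \<pi>" by (auto simp: abs_perm_def)
  moreover have "odd (neg n (B_gen 0 \<circ> \<pi>) + neg n \<pi>)"
    unfolding neg_def
  proof (rule odd_card_toggle)
    show "finite (Neg n \<pi>)" by (rule finite_subset[of _ "{1..int n}"]) (auto simp: Neg_def)
    have "B_gen 0 v < 0 \<longleftrightarrow> (v < 0) \<noteq> (\<bar>v\<bar> = 1)" for v
      by (auto simp: B_gen_def transpose_def)
    thus "j \<in> Neg n (B_gen 0 \<circ> \<pi>) \<longleftrightarrow> (j \<in> Neg n \<pi>) \<noteq> (j = p)" for j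
      using one[of j] p(1) by (auto simp: Neg_def)
  qed
  ultimately show ?thesis using True by (simp add: length_parity_def)
next
  case False
  define s where "s = transpose (int i) (int i + 1)"
  have s: "\<bar>B_gen i v\<bar> = s \<bar>v\<bar>" if "v \<noteq> 0" for v
    using False that by (auto simp: B_gen_def transpose_def s_def)
  have "B_gen i v < 0 \<longleftrightarrow> v < 0" for v
    using False by (auto simp: B_gen_def transpose_def)
  hence neg: "neg n (B_gen i \<circ> \<pi>) = neg n \<pi>" by (simp add: neg_def Neg_def)
  obtain p where p: "p \<in> {1..int n}" "\<bar>\<pi> p\<bar> = int i"
    using signed_perms_surj[OF \<pi>, of "int i"] i False by auto
  obtain r where r: "r \<in> {1..int n}" "\<bar>\<pi> r\<bar> = int i + 1"
    using signed_perms_surj[OF \<pi>, of "int i + 1"] i by auto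
  have pi: "\<bar>\<pi> j\<bar> = int i \<longleftrightarrow> j = p" if "j \<in> {1..int n}" for j
    using signed_perms_abs_inj[OF \<pi>, of j p] that p by auto
  have ri: "\<bar>\<pi> j\<bar> = int i + 1 \<longleftrightarrow> j = r" if "j \<in> {1..int n}" for j
    using signed_perms_abs_inj[OF \<pi>, of j r] that r by auto
  have neq: "\<bar>\<pi> j\<bar> \<noteq> \<bar>\<pi> k\<bar>" if "j \<in> {1..int n}" "k \<in> {1..int n}" "j \<noteq> k" for j k
    using signed_perms_abs_inj[OF \<pi>, of j k] that by auto
  \<comment> \<open>Exchanging two neighbouring integers preserves every other comparison.\<close>
  have ss: "s v < s w \<longleftrightarrow> (v < w) \<noteq> ({v, w} = {int i, int i + 1})" if "v \<noteq> w" for v w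
    using that by (auto simp: s_def transpose_def doubleton_eq_iff)
  have "odd (inv_num n (abs_perm n (B_gen i \<circ> \<pi>)) + inv_num n (abs_perm n \<pi>))"
    unfolding inv_num_def
  proof (rule odd_card_toggle)
    show "finite {(j, k). 1 \<le> j \<and> j < k \<and> k \<le> int n \<and> abs_perm n \<pi> k < abs_perm n \<pi> j}"
      by (rule finite_subset[of _ "{1..int n} \<times> {1..int n}"]) auto
    fix x :: "int \<times> int"
    obtain j k where x: "x = (j, k)" by (cases x)
    have pr: "p \<noteq> r" using p r by auto
    show "x \<in> {(j, k). 1 \<le> j \<and> j < k \<and> k \<le> int n \<and>
        abs_perm n (B_gen i \<circ> \<pi>) k < abs_perm n (B_gen i \<circ> \<pi>) j} \<longleftrightarrow>
      (x \<in> {(j, k). 1 \<le> j \<and> j < k \<and> k \<le> int n \<and> abs_perm n \<pi> k < abs_perm n \<pi> j})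
        \<noteq> (x = (min p r, max p r))"
    proof (cases "1 \<le> j \<and> j < k \<and> k \<le> int n")
      case True
      hence jk: "j \<in> {1..int n}" "k \<in> {1..int n}" "j < k" by auto
      have "abs_perm n (B_gen i \<circ> \<pi>) l = s \<bar>\<pi> l\<bar>" if "l \<in> {1..int n}" for l
        using s[of "\<pi> l"] signed_perms_abs_range[OF \<pi> that] that by (auto simp: abs_perm_def)
      moreover have "{\<bar>\<pi> k\<bar>, \<bar>\<pi> j\<bar>} = {int i, int i + 1} \<longleftrightarrow> (j, k) = (min p r, max p r)"
        using pi[of j] pi[of k] ri[of j] ri[of k] jk pr
        by (auto simp: doubleton_eq_iff min_def max_def)
      ultimately show ?thesis
        using jk True ss[OF neq[of k j]] by (auto simp: x abs_perm_def)
    next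
      case False
      thus ?thesis using p(1) r(1) pr by (auto simp: x min_def max_def split: if_splits)
    qed
  qed
  thus ?thesis unfolding length_parity_def neg by presburger
qed

lemma id_signed_perms: "id \<in> signed_perms n"
  by (simp add: signed_perms_def permutes_id)

lemma length_parity_id: "length_parity n id = 0"
proof -
  have "{(i, j). 1 \<le> i \<and> i < j \<and> j \<le> int n \<and> abs_perm n id i > abs_perm n id j} = {}"
    by (auto simp: abs_perm_def)
  moreover have "Neg n id = {}" by (auto simp: Neg_def)
  ultimately show ?thesis by (simp only: length_parity_def inv_num_def neg_def card.empty add_0)
qed

lemma even_length_parity_word:
  assumes "set ws \<subseteq> {..<n}"
  shows "foldr (\<circ>) (map B_gen ws) id \<in> signed_perms n
    \<and> even (length ws + length_parity n (foldr (\<circ>) (map B_gen ws) id))"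
  using assms
proof (induction ws)
  case Nil
  show ?case using id_signed_perms[of n] length_parity_id[of n] by (simp add: id_def)
next
  case (Cons i ws)
  let ?\<pi> = "foldr (\<circ>) (map B_gen ws) id"
  have i: "i < n" and ws: "set ws \<subseteq> {..<n}" using Cons.prems by auto
  note IH = Cons.IH[OF ws, THEN conjunct1] Cons.IH[OF ws, THEN conjunct2]
  have "foldr (\<circ>) (map B_gen (i # ws)) id = B_gen i \<circ> ?\<pi>" by simp
  moreover have "even (Suc l + b)" if "odd (b + a)" "even (l + a)" for l a b :: nat
    using that by presburger
  from this[OF odd_length_parity_B_gen[OF IH(1) i] IH(2)]
  have "even (length (i # ws) + length_parity n (B_gen i \<circ> ?\<pi>))" by (simp only: list.size add_Suc_right add_0_right)
  ultimately show ?case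
    using signed_perms_compose[OF B_gen_signed_perms[OF i] IH(1)] by (simp only:)
qed

lemma foldr_comp_append: "foldr (\<circ>) (fs @ gs) id = foldr (\<circ>) fs id \<circ> foldr (\<circ>) gs id"
  by (induction fs) (simp_all add: comp_assoc)

text \<open>Integer values that increase strictly grow by at least \<open>1\<close> per step, so \<open>i \<le> \<pi> i\<close> follows upwards
  from \<open>i = 1\<close> and \<open>\<pi> i \<le> i\<close> downwards from \<open>i = n\<close>.\<close>

lemma signed_perms_ascending_id:
  assumes \<pi>: "\<pi> \<in> signed_perms n"
    and asc: "\<And>i. 1 \<le> i \<Longrightarrow> i < int n \<Longrightarrow> \<pi> i < \<pi> (i + 1)"
    and pos: "n \<ge> 1 \<Longrightarrow> \<pi> 1 > 0"
  shows "\<pi> = id"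
proof -
  have lower: "int (Suc k) \<le> \<pi> (int (Suc k))" if "k < n" for k
    using that
  proof (induction k)
    case 0
    thus ?case using pos by simp
  next
    case (Suc k)
    thus ?case using asc[of "int (Suc k)"] by (simp add: add.commute)
  qed
  have upper: "\<pi> (int n - int k) \<le> int n - int k" if "k < n" for k
    using that
  proof (induction k)
    case 0
    thus ?case using signed_perms_abs_range[OF \<pi>, of "int n"] by auto
  next
    case (Suc k)
    have "\<pi> (int n - int (Suc k)) < \<pi> (int n - int (Suc k) + 1)"
      by (rule asc) (use Suc.prems in auto)
    thus ?case using Suc by simp
  qed
  have eq: "\<pi> i = i" if "i \<in> {1..int n}" for i
  proof -
    have "nat (i - 1) < n" "nat (int n - i) < n" using that by auto
    from lower[OF this(1)] upper[OF this(2)] show ?thesis using that by auto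
  qed
  show ?thesis
  proof
    fix i
    consider "i \<in> {1..int n}" | "- i \<in> {1..int n}" | "i \<notin> signed_ground n"
      by (force simp: signed_ground_def)
    thus "\<pi> i = id i"
    proof cases
      case 2
      thus ?thesis using eq[of "- i"] signed_perms_neg[OF \<pi>, of i] by simp
    next
      case 3
      thus ?thesis using \<pi> by (auto simp: signed_perms_def permutes_not_in)
    qed (use eq in auto)
  qed
qed

text \<open>Composition on the right acts on positions. Exchanging the values of a descent, or making a negative
  first value positive, increases \<open>\<Sum>k. k * \<pi> k\<close>, and one of the two is possible
  unless the permutation is the identity. This sum serves as the termination measure below: unlike
  the inversion number, it reacts to both kinds of generators in the same direction.\<close>

lemma exists_B_gen_increase:
  assumes \<pi>: "\<pi> \<in> signed_perms n" and "\<pi> \<noteq> id"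
  obtains i where "i < n"
    and "(\<Sum>k\<in>{1..int n}. k * \<pi> k) < (\<Sum>k\<in>{1..int n}. k * (\<pi> \<circ> B_gen i) k)"
proof -
  \<comment> \<open>Only the positions moved by the generator contribute to the change.\<close>
  have diff: "(\<Sum>k\<in>{1..int n}. k * \<sigma> k) - (\<Sum>k\<in>{1..int n}. k * \<pi> k)
      = (\<Sum>k\<in>T. k * (\<sigma> k - \<pi> k))"
    if "T \<subseteq> {1..int n}" "\<And>k. k \<in> {1..int n} - T \<Longrightarrow> \<sigma> k = \<pi> k" for \<sigma> T
  proof -
    have "(\<Sum>k\<in>T. k * (\<sigma> k - \<pi> k)) = (\<Sum>k\<in>{1..int n}. k * (\<sigma> k - \<pi> k))"
      by (rule sum.mono_neutral_left) (use that in auto)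
    thus ?thesis by (simp add: algebra_simps sum_subtractf)
  qed
  have "(\<exists>i. 1 \<le> i \<and> i < int n \<and> \<not> \<pi> i < \<pi> (i + 1)) \<or> (n \<ge> 1 \<and> \<not> \<pi> 1 > 0)"
    using signed_perms_ascending_id[OF \<pi>] \<open>\<pi> \<noteq> id\<close> by blast
  thus thesis
  proof
    assume "\<exists>i. 1 \<le> i \<and> i < int n \<and> \<not> \<pi> i < \<pi> (i + 1)"
    then obtain k where k: "1 \<le> k" "k < int n" "\<not> \<pi> k < \<pi> (k + 1)" by auto
    define i where "i = nat k"
    have i: "k = int i" "1 \<le> i" "i < n" using k by (auto simp: i_def)
    have "\<pi> (k + 1) < \<pi> k"
      using k signed_perms_inj[OF \<pi>, of k "k + 1"] by linarith
    moreover have "(\<Sum>k\<in>{1..int n}. k * (\<pi> \<circ> B_gen i) k) - (\<Sum>k\<in>{1..int n}. k * \<pi> k)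
        = (\<Sum>j\<in>{k, k + 1}. j * ((\<pi> \<circ> B_gen i) j - \<pi> j))"
      by (rule diff) (use i in \<open>auto simp: B_gen_def transpose_def\<close>)
    moreover have "B_gen i k = k + 1" "B_gen i (k + 1) = k"
      using i by (auto simp: B_gen_def transpose_def)
    ultimately show thesis using i(3) by (intro that[of i]) (simp_all add: algebra_simps)
  next
    assume 1: "n \<ge> 1 \<and> \<not> \<pi> 1 > 0"
    hence "\<pi> 1 < 0" using signed_perms_abs_range[OF \<pi>, of 1] by auto
    moreover have "(\<Sum>k\<in>{1..int n}. k * (\<pi> \<circ> B_gen 0) k) - (\<Sum>k\<in>{1..int n}. k * \<pi> k)
        = (\<Sum>j\<in>{1}. j * ((\<pi> \<circ> B_gen 0) j - \<pi> j))"
      by (rule diff) (use 1 in \<open>auto simp: B_gen_def transpose_def\<close>)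
    moreover have "B_gen 0 1 = -1" by (simp add: B_gen_def)
    ultimately show thesis
      using 1 signed_perms_neg[OF \<pi>, of 1] by (intro that[of 0]) simp_all
  qed
qed

text \<open>The length is defined as a least word length, so its parity is only meaningful once some word is known
  to exist. Sorting a signed permutation by the steps of \<open>exists_B_gen_increase\<close> yields one,
  since the generators are involutions.\<close>

lemma signed_perms_generated:
  assumes "\<pi> \<in> signed_perms n"
  shows "\<exists>ws. set ws \<subseteq> {..<n} \<and> foldr (\<circ>) (map B_gen ws) id = \<pi>"
  using assms
proof (induction "nat (\<Sum>k\<in>{1..int n}. k * (int n - \<pi> k))" arbitrary: \<pi> rule: less_induct)
  case less
  show ?case
  proof (cases "\<pi> = id")
    case True
    thus ?thesis by (intro exI[of _ "[]"]) simp
  next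
    case False
    obtain i where i: "i < n"
      and incr: "(\<Sum>k\<in>{1..int n}. k * \<pi> k) < (\<Sum>k\<in>{1..int n}. k * (\<pi> \<circ> B_gen i) k)"
      by (rule exists_B_gen_increase[OF less.prems False])
    let ?\<sigma> = "\<pi> \<circ> B_gen i"
    have \<sigma>: "?\<sigma> \<in> signed_perms n"
      by (rule signed_perms_compose[OF less.prems B_gen_signed_perms[OF i]])
    have "0 \<le> (\<Sum>k\<in>{1..int n}. k * (int n - ?\<sigma> k))"
    proof (rule sum_nonneg)
      fix k assume "k \<in> {1..int n}"
      thus "0 \<le> k * (int n - ?\<sigma> k)" using signed_perms_abs_range[OF \<sigma>, of k] by auto
    qed
    moreover have "(\<Sum>k\<in>{1..int n}. k * (int n - ?\<sigma> k)) < (\<Sum>k\<in>{1..int n}. k * (int n - \<pi> k))"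
      using incr by (simp add: right_diff_distrib sum_subtractf)
    ultimately obtain ws where ws: "set ws \<subseteq> {..<n}" "foldr (\<circ>) (map B_gen ws) id = ?\<sigma>"
      using less.hyps[OF _ \<sigma>] by auto
    have "foldr (\<circ>) (map B_gen (ws @ [i])) id = ?\<sigma> \<circ> B_gen i"
      using ws(2) by (simp only: map_append foldr_comp_append) simp
    also have "\<dots> = \<pi>" by (simp add: fun_eq_iff B_gen_involution)
    finally show ?thesis using ws(1) i by (intro exI[of _ "ws @ [i]"]) auto
  qed
qed

lemma even_B_length_parity:
  assumes \<pi>: "\<pi> \<in> signed_perms n"
  shows "even (B_length n \<pi> + length_parity n \<pi>)"
proof -
  have "\<exists>k ws. length ws = k \<and> set ws \<subseteq> {..<n} \<and> foldr (\<circ>) (map B_gen ws) id = \<pi>"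
    using signed_perms_generated[OF \<pi>] by auto
  hence "\<exists>ws. length ws = B_length n \<pi> \<and> set ws \<subseteq> {..<n} \<and> foldr (\<circ>) (map B_gen ws) id = \<pi>"
    unfolding B_length_def by (rule LeastI_ex)
  then obtain ws where ws: "length ws = B_length n \<pi>" "set ws \<subseteq> {..<n}"
    "foldr (\<circ>) (map B_gen ws) id = \<pi>" by (elim exE conjE)
  show ?thesis using even_length_parity_word[OF ws(2)] unfolding ws(1,3) by (rule conjunct2)
qed

lemma card_Negval:
  assumes "\<pi> \<in> signed_perms n"
  shows "card (Negval n \<pi>) = neg n \<pi>"
  unfolding Negval_def neg_def
  by (rule card_image) (auto simp: inj_on_def signed_perms_inj[OF assms])

lemma minus_one_B_length:
  assumes \<pi>: "\<pi> \<in> signed_perms n"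
  shows "(-1 :: 'a::comm_ring_1) ^ B_length n \<pi>
    = (-1) ^ inv_num n \<pi> * (\<Prod>j\<in>Negval n \<pi>. (-1) ^ nat j)"
proof -
  have "(-1 :: 'a) ^ B_length n \<pi> = (-1) ^ length_parity n \<pi>"
    by (rule power_cong_parity) (simp_all add: even_B_length_parity[OF \<pi>, simplified])
  also have "\<dots> = (-1) ^ inv_num n \<pi> * (\<Prod>j\<in>Negval n \<pi>. (-1) ^ (nat j - 1) * (-1))"
    by (simp add: length_parity_def power_add minus_one_inv_abs_perm[OF \<pi>] card_Negval[OF \<pi>, symmetric]
        prod.distrib del: mult_minus_right mult_minus_left mult_minus1_right)
  also have "(\<Prod>j\<in>Negval n \<pi>. (-1 :: 'a) ^ (nat j - 1) * (-1)) = (\<Prod>j\<in>Negval n \<pi>. (-1) ^ nat j)"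
  proof (rule prod.cong[OF refl])
    fix j assume "j \<in> Negval n \<pi>"
    hence "nat j = Suc (nat j - 1)" using Negval_subset[OF \<pi>] by force
    thus "(-1 :: 'a) ^ (nat j - 1) * (-1) = (-1) ^ nat j" by (metis power_Suc2)
  qed
  finally show ?thesis .
qed

section \<open>Characters of the hyperoctahedral group and the flag major index\<close>

lemma qbracket_2: "qbracket 2 p = 1 + p"
proof -
  have "{..<2::nat} = {0, 1}" by auto
  thus ?thesis by (simp add: qbracket_def)
qed

text \<open>The common form of the three identities: every sign in question consists of a factor \<open>e\<close> for each
  inversion and a factor \<open>x j\<close> for each negated value \<open>j\<close>. Since the exponent is twice the major index plus
  the number of negated values, \<open>q\<^sup>2\<close> goes with \<open>maj\<close>, and one factor \<open>q\<close> with each negated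
  value.\<close>

lemma sum_signed_perms_Fmaj:
  fixes q e :: "'a::comm_ring_1" and x :: "nat \<Rightarrow> 'a"
  assumes "e * e = 1"
    and \<chi>: "\<And>\<pi>. \<pi> \<in> signed_perms n \<Longrightarrow> \<chi> \<pi> = e ^ inv_num n \<pi> * (\<Prod>j\<in>Negval n \<pi>. x (nat j))"
  shows "(\<Sum>\<pi>\<in>signed_perms n. \<chi> \<pi> * q ^ Fmaj n \<pi>)
    = (\<Prod>k=1..n. qbracket 2 (x k * q) * qbracket k (e ^ (k - 1) * q\<^sup>2))"
proof -
  have "(\<Sum>\<pi>\<in>signed_perms n. \<chi> \<pi> * q ^ Fmaj n \<pi>)
      = (\<Sum>\<pi>\<in>signed_perms n. e ^ inv_num n \<pi> * (\<Prod>j\<in>Negval n \<pi>. x (nat j) * q) * (q\<^sup>2) ^ maj n \<pi>)"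
  proof (rule sum.cong[OF refl])
    fix \<pi> assume \<pi>: "\<pi> \<in> signed_perms n"
    have "(\<Prod>j\<in>Negval n \<pi>. x (nat j) * q) = (\<Prod>j\<in>Negval n \<pi>. x (nat j)) * q ^ neg n \<pi>"
      by (simp add: prod.distrib card_Negval[OF \<pi>])
    moreover have "q ^ Fmaj n \<pi> = q ^ neg n \<pi> * (q\<^sup>2) ^ maj n \<pi>"
      unfolding Fmaj_def power_add power_mult by (rule mult.commute)
    ultimately show "\<chi> \<pi> * q ^ Fmaj n \<pi> = e ^ inv_num n \<pi>
        * (\<Prod>j\<in>Negval n \<pi>. x (nat j) * q) * (q\<^sup>2) ^ maj n \<pi>"
      by (simp only: \<chi>[OF \<pi>] mult.assoc)
  qed
  also have "\<dots> = (\<Prod>k=1..n. (1 + x k * q) * qbracket k (e ^ (k - 1) * q\<^sup>2))"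
    by (rule sum_signed_perms_inv_maj[OF assms(1), where y = "\<lambda>k. x k * q"])
  finally show ?thesis by (simp only: qbracket_2)
qed

theorem theorem3p4:
  fixes n :: nat and q :: "'a::comm_ring_1"
  assumes "n \<ge> 1"
  shows "(\<Sum>\<pi>\<in>signed_perms n. (-1) ^ B_length n \<pi> * q ^ Fmaj n \<pi>)
           = (\<Prod>k=1..n. qbracket 2 ((-1) ^ k * q) * qbracket k ((-1) ^ (k - 1) * q\<^sup>2))
       \<and> (\<Sum>\<pi>\<in>signed_perms n. (-1) ^ neg n \<pi> * q ^ Fmaj n \<pi>)
           = (\<Prod>k=1..n. qbracket 2 (- q) * qbracket k (q\<^sup>2))
       \<and> (\<Sum>\<pi>\<in>signed_perms n. (-1) ^ inv_num n (abs_perm n \<pi>) * q ^ Fmaj n \<pi>)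
           = (\<Prod>k=1..n. qbracket 2 ((-1) ^ (k - 1) * q) * qbracket k ((-1) ^ (k - 1) * q\<^sup>2))"
proof (intro conjI)
  show "(\<Sum>\<pi>\<in>signed_perms n. (-1) ^ B_length n \<pi> * q ^ Fmaj n \<pi>)
           = (\<Prod>k=1..n. qbracket 2 ((-1) ^ k * q) * qbracket k ((-1) ^ (k - 1) * q\<^sup>2))"
    by (rule sum_signed_perms_Fmaj) (simp_all add: minus_one_B_length)
  have "(\<Sum>\<pi>\<in>signed_perms n. (-1) ^ neg n \<pi> * q ^ Fmaj n \<pi>)
      = (\<Prod>k=1..n. qbracket 2 (-1 * q) * qbracket k (1 ^ (k - 1) * q\<^sup>2))"
    by (rule sum_signed_perms_Fmaj) (simp_all add: card_Negval)
  thus "(\<Sum>\<pi>\<in>signed_perms n. (-1) ^ neg n \<pi> * q ^ Fmaj n \<pi>)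
           = (\<Prod>k=1..n. qbracket 2 (- q) * qbracket k (q\<^sup>2))"
    by simp
  show "(\<Sum>\<pi>\<in>signed_perms n. (-1) ^ inv_num n (abs_perm n \<pi>) * q ^ Fmaj n \<pi>)
           = (\<Prod>k=1..n. qbracket 2 ((-1) ^ (k - 1) * q) * qbracket k ((-1) ^ (k - 1) * q\<^sup>2))"
    by (rule sum_signed_perms_Fmaj) (simp_all add: minus_one_inv_abs_perm)
qed

end
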